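(* Let $G$ be a group with a finite generating set $A$ closed under inversion. Suppose that $G$ has a length non-increasing synchronously regular convergent prefix-rewriting system over the alphabet $A$. Then $G$ is almost convex with respect to $A$.
   Context: $A^*$ is the set of words over $A$; $|u|$ is the length of a word $u$. Synchronous regularity: a set $R\subseteq A^*\times A^*$ is synchronously regular if the set of padded pairs is a regular language, where a pair $(u,v)\in R$ is padded by appending a padding symbol $\$\notin A$ to the end of the shorter word until both have length $\max(|u|,|v|)$, and the result is regarded as a word over $(A\cup\{\$\})\times(A\cup\{\$\})$. Convergent prefix-rewriting system for $G$ over $A$: a set $R\subseteq A^*\times A^*$ such that $G$ is presented as a monoid by $\mathrm{Mon}\langle A\mid \{u=v : (u,v)\in R\}\rangle$, and the rewritings $uw\to_R vw$ (for $(u,v)\in R$, $w\in A^*$) satisfy: (termination) there is no infinite chain $w_1\to_R w_2\to_R\cdots$; (normal forms) each element of $G$ is represented by exactly one irreducible word (a word that cannot be rewritten). $R$ is length non-increasing if $|v|\le|u|$ for every $(u,v)\in R$. Almost convexity: let $\Gamma_{G,A}$ be the Cayley graph with path metric $d_{G,A}$, and let $S(n)$ and $B(n)$ be the sphere and ball of radius $n$ centered at $1_G$. $G$ is almost convex with respect to $A$ if there is a constant $k$ such that for all $n\in\mathbb{N}$ and all $g,h\in S(n)$ with $d_{G,A}(g,h)\le 2$, there is a path from $g$ to $h$ of length at most $k$ lying inside $B(n)$. *)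

theory Defs
  imports "HOL-Algebra.Generated_Groups" "Graph_Theory.Digraph_Component"
begin

section \<open>Regular languages and synchronously regular relations\<close>

text \<open>
  Regularity means acceptance by a complete deterministic finite automaton with input alphabet
  \<open>\<Sigma>\<close>. Every finite state set can be relabelled by natural numbers, so taking the states
  in \<open>nat\<close> is no restriction.
\<close>

definition regular_language :: "'s set \<Rightarrow> 's list set \<Rightarrow> bool" where
  "regular_language \<Sigma> L \<longleftrightarrow>
     (\<exists>(Q :: nat set) q0 \<delta> F.
        finite Q \<and> q0 \<in> Q \<and> F \<subseteq> Q \<and> (\<forall>q\<in>Q. \<forall>s\<in>\<Sigma>. \<delta> q s \<in> Q) \<and>
        L = {w \<in> lists \<Sigma>. foldl \<delta> q0 w \<in> F})"

text \<open>
  The padding symbol is \<open>None\<close>. Subtraction on \<open>nat\<close> truncates at \<open>0\<close>, so only the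
  shorter of the two words is extended.
\<close>

definition pad :: "'a list \<times> 'a list \<Rightarrow> ('a option \<times> 'a option) list" where
  "pad = (\<lambda>(u, v).
     zip (map Some u @ replicate (length v - length u) None)
         (map Some v @ replicate (length u - length v) None))"

definition synchronously_regular :: "'a set \<Rightarrow> ('a list \<times> 'a list) set \<Rightarrow> bool" where
  "synchronously_regular A R \<longleftrightarrow>
     R \<subseteq> lists A \<times> lists A \<and>
     regular_language (insert None (Some ` A) \<times> insert None (Some ` A)) (pad ` R)"

section \<open>Monoid presentations\<close>

inductive_set mon_cong :: "'a set \<Rightarrow> ('a list \<times> 'a list) set \<Rightarrow> ('a list \<times> 'a list) set"
  for A R where
    base: "(u, v) \<in> R \<Longrightarrow> (u, v) \<in> mon_cong A R"
  | refl: "w \<in> lists A \<Longrightarrow> (w, w) \<in> mon_cong A R"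
  | sym: "(u, v) \<in> mon_cong A R \<Longrightarrow> (v, u) \<in> mon_cong A R"
  | trans: "(u, v) \<in> mon_cong A R \<Longrightarrow> (v, w) \<in> mon_cong A R \<Longrightarrow> (u, w) \<in> mon_cong A R"
  | compat: "(u, v) \<in> mon_cong A R \<Longrightarrow> x \<in> lists A \<Longrightarrow> y \<in> lists A \<Longrightarrow>
      (x @ u @ y, x @ v @ y) \<in> mon_cong A R"

text \<open>The product of two classes is the class of any concatenation of representatives.\<close>

definition Mon :: "'a set \<Rightarrow> ('a list \<times> 'a list) set \<Rightarrow> 'a list set monoid" where
  "Mon A R =
     \<lparr>carrier = lists A // mon_cong A R,
      monoid.mult = (\<lambda>X Y. \<Union>x\<in>X. \<Union>y\<in>Y. mon_cong A R `` {x @ y}),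
      one = mon_cong A R `` {[]}\<rparr>"

text \<open>
  The alphabet \<open>A\<close> is a subset of \<open>G\<close>, so the isomorphism has to send the class of each
  one-letter word to that letter.
\<close>

definition presented_by ::
    "('a, 'b) monoid_scheme \<Rightarrow> 'a set \<Rightarrow> ('a list \<times> 'a list) set \<Rightarrow> bool" where
  "presented_by G A R \<longleftrightarrow>
     (\<exists>\<phi> \<in> iso (Mon A R) G. \<forall>a\<in>A. \<phi> (mon_cong A R `` {[a]}) = a)"

section \<open>Convergent prefix-rewriting systems\<close>

definition word_value :: "('a, 'b) monoid_scheme \<Rightarrow> 'a list \<Rightarrow> 'a" where
  "word_value G w = foldr (\<otimes>\<^bsub>G\<^esub>) w \<one>\<^bsub>G\<^esub>"

definition prefix_step ::
    "'a set \<Rightarrow> ('a list \<times> 'a list) set \<Rightarrow> ('a list \<times> 'a list) set" where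
  "prefix_step A R = {(u @ w, v @ w) | u v w. (u, v) \<in> R \<and> w \<in> lists A}"

definition irreducible_word :: "'a set \<Rightarrow> ('a list \<times> 'a list) set \<Rightarrow> 'a list \<Rightarrow> bool" where
  "irreducible_word A R w \<longleftrightarrow> w \<in> lists A \<and> \<not> (\<exists>w'. (w, w') \<in> prefix_step A R)"

definition convergent_prefix_rewriting_system ::
    "('a, 'b) monoid_scheme \<Rightarrow> 'a set \<Rightarrow> ('a list \<times> 'a list) set \<Rightarrow> bool" where
  "convergent_prefix_rewriting_system G A R \<longleftrightarrow>
     R \<subseteq> lists A \<times> lists A \<and>
     presented_by G A R \<and>
     \<not> (\<exists>f :: nat \<Rightarrow> 'a list. \<forall>i. (f i, f (Suc i)) \<in> prefix_step A R) \<and>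
     (\<forall>g \<in> carrier G. \<exists>!w. irreducible_word A R w \<and> word_value G w = g)"

definition length_nonincreasing :: "('a list \<times> 'a list) set \<Rightarrow> bool" where
  "length_nonincreasing R \<longleftrightarrow> (\<forall>(u, v) \<in> R. length v \<le> length u)"

section \<open>Cayley graphs and almost convexity\<close>

text \<open>
  The edge labelled \<open>a\<close> at \<open>g\<close> runs from \<open>g\<close> to \<open>g \<otimes> a\<close>. When \<open>A\<close> is closed under
  inversion, every edge can be traversed backwards along another edge, so directed walks in
  this digraph are the paths of the undirected Cayley graph.
\<close>

definition Cayley_graph ::
    "('a, 'b) monoid_scheme \<Rightarrow> 'a set \<Rightarrow> ('a, 'a \<times> 'a) pre_digraph" where
  "Cayley_graph G A =
     \<lparr>verts = carrier G, arcs = carrier G \<times> A, tail = fst, head = (\<lambda>(g, a). g \<otimes>\<^bsub>G\<^esub> a)\<rparr>"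

text \<open>
  The value is the path distance only if \<open>h\<close> can be reached from \<open>g\<close>; this always holds when
  \<open>A\<close> generates \<open>G\<close> and is closed under inversion.
\<close>

definition Cayley_dist :: "('a, 'b) monoid_scheme \<Rightarrow> 'a set \<Rightarrow> 'a \<Rightarrow> 'a \<Rightarrow> nat" where
  "Cayley_dist G A g h =
     (LEAST n. \<exists>p. pre_digraph.awalk (Cayley_graph G A) g p h \<and> length p = n)"

definition Cayley_sphere :: "('a, 'b) monoid_scheme \<Rightarrow> 'a set \<Rightarrow> nat \<Rightarrow> 'a set" where
  "Cayley_sphere G A n = {g \<in> carrier G. Cayley_dist G A \<one>\<^bsub>G\<^esub> g = n}"

definition Cayley_ball :: "('a, 'b) monoid_scheme \<Rightarrow> 'a set \<Rightarrow> nat \<Rightarrow> 'a set" where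
  "Cayley_ball G A n = {g \<in> carrier G. Cayley_dist G A \<one>\<^bsub>G\<^esub> g \<le> n}"

text \<open>
  Spheres and balls are sets of vertices; a path lies inside the ball when it is a path of the
  subgraph induced by the ball.
\<close>

definition almost_convex :: "('a, 'b) monoid_scheme \<Rightarrow> 'a set \<Rightarrow> bool" where
  "almost_convex G A \<longleftrightarrow>
     (\<exists>k :: nat. \<forall>n :: nat.
        \<forall>g \<in> Cayley_sphere G A n. \<forall>h \<in> Cayley_sphere G A n.
          Cayley_dist G A g h \<le> 2 \<longrightarrow>
          (\<exists>p. pre_digraph.awalk (Cayley_graph G A \<restriction> Cayley_ball G A n) g p h \<and> length p \<le> k))"

end

theory Submission
  imports Defs
begin

text \<open>
  Normal forms are geodesic because rewriting preserves group elements and does not lengthen words.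
  Every live state of the automaton accepting the padded rules has a completion of bounded length,
  so the two sides of a rule fellow-travel with a uniform constant.

  The essential case is \<open>g, h \<in> S(n)\<close> with a common neighbour \<open>e \<in> S(n+1)\<close>. Let \<open>w\<close> be the normal
  form of \<open>g\<close> and \<open>e = ga\<close>. If \<open>wa\<close> is reducible, its proper prefixes are irreducible, so \<open>wa\<close> is the
  whole left-hand side of a rule \<open>wa \<rightarrow> xc\<close>, and by fellow-travelling \<open>w\<close> and \<open>x\<close> are joined by a
  bounded path inside \<open>B(n)\<close>. Replacing \<open>x\<close> by its normal form does not move the vertex \<open>x\<close>, and
  iterating leads by termination to the normal form of \<open>e\<close>. All vertices met in this way are
  neighbours of \<open>e\<close>, so boundedly many moves suffice. Hence \<open>g\<close>, and likewise \<open>h\<close>, is joined inside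
  \<open>B(n)\<close> by a bounded path to the penultimate vertex of the normal form of \<open>e\<close>.
\<close>

section \<open>Padded pairs accepted by a finite automaton\<close>

lemma foldl_closed:
  assumes "\<forall>q\<in>Q. \<forall>s\<in>S. \<delta> q s \<in> Q" "q \<in> Q" "w \<in> lists S"
  shows "foldl \<delta> q w \<in> Q"
  using assms(3,2) by (induction w arbitrary: q) (use assms(1) in auto)

lemma length_pad: "length (pad (u, v)) = max (length u) (length v)"
  by (simp add: pad_def max_def)

lemma take_pad:
  assumes "m \<le> length u" "m \<le> length v"
  shows "take m (pad (u, v)) = zip (map Some (take m u)) (map Some (take m v))"
  using assms by (simp add: pad_def take_zip take_map)

text \<open>An accepted word that begins with \<open>m\<close> pairs of genuine letters is known
  only to be the padding of some rule; this recovers the prefixes of that rule. Padding occurs only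
  at the end of a word, so both words supply these letters themselves.\<close>

lemma take_eq_if_take_pad_eq:
  assumes eq: "take m (pad (u', v')) = zip (map Some p) (map Some q)"
    and len: "length p = m" "length q = m"
  shows "take m u' = p" "take m v' = q"
proof -
  have big: "m \<le> max (length u') (length v')"
    using arg_cong[OF eq, of length] len by (simp add: length_pad)
  let ?U = "map Some u' @ replicate (length v' - length u') None"
  let ?V = "map Some v' @ replicate (length u' - length v') None"
  have lU: "length ?U = max (length u') (length v')" "length ?V = max (length u') (length v')"
    by auto
  have z: "zip (take m ?U) (take m ?V) = zip (map Some p) (map Some q)"
    using eq unfolding pad_def by (simp only: prod.case take_zip)
  have "length (take m ?U) = length (map Some p)" "length (take m ?V) = length (map Some q)"
    using lU big len by (simp_all only: length_take length_map min_absorb2)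
  then have "length (take m ?U) = length (take m ?V)" using len by simp
  then have "map fst (zip (take m ?U) (take m ?V)) = take m ?U"
    "map snd (zip (take m ?U) (take m ?V)) = take m ?V"
    by (simp_all only: map_fst_zip map_snd_zip)
  moreover have "map fst (zip (map Some p) (map Some q)) = map Some p"
    "map snd (zip (map Some p) (map Some q)) = map Some q"
    using len by simp_all
  ultimately have tU: "take m ?U = map Some p" and tV: "take m ?V = map Some q"
    unfolding z by (simp_all only:)
  have aux: "take m x = r"
    if e: "take m (map Some x @ replicate j None) = map Some r" and lr: "length r = m"
    for x r :: "'a list" and j
  proof -
    \<comment> \<open>A truncation of full length \<open>m\<close> would reach into the padding if
      \<open>x\<close> were shorter than \<open>m\<close>.\<close>
    have "None \<notin> set (take m (map Some x @ replicate j None))"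
      unfolding e by auto
    moreover have "length (take m (map Some x @ replicate j None)) = m"
      unfolding e using lr by simp
    ultimately have "m \<le> length x"
      by (cases "m \<le> length x") auto
    then have "map Some (take m x) = map Some r"
      using e by (simp add: take_map)
    then show ?thesis by (simp add: inj_map_eq_map)
  qed
  show "take m u' = p" using aux[OF tU len(1)] .
  show "take m v' = q" using aux[OF tV len(2)] .
qed

text \<open>The bound \<open>C\<close> is the largest among shortest completions of the states that can be completed.\<close>

lemma synchronously_regular_completion:
  assumes "synchronously_regular A R"
  obtains C where "\<And>u v m. (u, v) \<in> R \<Longrightarrow> m \<le> length u \<Longrightarrow> m \<le> length v \<Longrightarrow>
    \<exists>r s. (take m u @ r, take m v @ s) \<in> R \<and> length r \<le> C \<and> length s \<le> C"
proof -
  define S where "S = insert None (Some ` A) \<times> insert None (Some ` A)"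
  obtain Q :: "nat set" and q0 \<delta> F where fin: "finite Q" "q0 \<in> Q"
    and closed: "\<forall>q\<in>Q. \<forall>s\<in>S. \<delta> q s \<in> Q"
    and L: "pad ` R = {w \<in> lists S. foldl \<delta> q0 w \<in> F}"
    using assms unfolding synchronously_regular_def regular_language_def S_def[symmetric] by blast
  \<comment> \<open>One accepted continuation is fixed per state; at a state without any, the value
    is an unspecified word. Either way its length is a number, and \<open>Q\<close> is finite, so
    the maximum is a bound.\<close>
  define comp where "comp q = (SOME w. w \<in> lists S \<and> foldl \<delta> q w \<in> F)" for q
  define C where "C = Max ((\<lambda>q. length (comp q)) ` Q)"
  show ?thesis
  proof (rule that[of C])
    fix u v m
    assume uv: "(u, v) \<in> R" and m: "m \<le> length u" "m \<le> length v"
    define P where "P = zip (map Some (take m u)) (map Some (take m v))"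
    define q where "q = foldl \<delta> q0 P"
    define D where "D = drop m (pad (u, v))"
    have padL: "pad (u, v) \<in> lists S" "foldl \<delta> q0 (pad (u, v)) \<in> F"
      using uv L by blast+
    have PD: "pad (u, v) = P @ D"
      unfolding P_def D_def take_pad[OF m, symmetric] by simp
    have P: "P \<in> lists S" and D: "D \<in> lists S" using padL(1) unfolding PD
      by (simp_all only: append_in_lists_conv)
    have q: "q \<in> Q" unfolding q_def by (rule foldl_closed[OF closed fin(2) P])
    \<comment> \<open>The rest of the given padded rule shows that acceptance can be reached from
      \<open>q\<close>, so the choice in \<open>comp q\<close> has a witness.\<close>
    have "D \<in> lists S \<and> foldl \<delta> q D \<in> F" using D padL(2) unfolding PD q_def foldl_append by blast
    then have c: "comp q \<in> lists S \<and> foldl \<delta> q (comp q) \<in> F"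
      unfolding comp_def by (rule someI)
    have "P @ comp q \<in> pad ` R" unfolding L using c P
      by (simp only: mem_Collect_eq append_in_lists_conv foldl_append q_def simp_thms)
    then obtain u' v' where u'v': "(u', v') \<in> R" and eq: "pad (u', v') = P @ comp q" by auto
    have lP: "length P = m" unfolding P_def using m by simp
    have "take m (pad (u', v')) = P" unfolding eq using lP by simp
    then have t: "take m u' = take m u" "take m v' = take m v"
      unfolding P_def by (rule take_eq_if_take_pad_eq; use m in simp)+
    \<comment> \<open>A padded pair is as long as its longer word, so one bound serves both
      remainders.\<close>
    have "max (length u') (length v') = m + length (comp q)"
      using arg_cong[OF eq, of length] lP by (simp add: length_pad)
    moreover have "length (comp q) \<le> C" unfolding C_def using fin(1) q by simp
    ultimately have "length (drop m u') \<le> C" "length (drop m v') \<le> C" by auto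
    moreover have "(take m u @ drop m u', take m v @ drop m v') \<in> R"
      unfolding t[symmetric] using u'v' by simp
    ultimately show "\<exists>r s. (take m u @ r, take m v @ s) \<in> R \<and> length r \<le> C \<and> length s \<le> C"
      by blast
  qed
qed

section \<open>Words and bounded paths inside balls\<close>

locale group_alphabet = group G for G (structure) +
  fixes A assumes A_carrier: "A \<subseteq> carrier G"
begin

section \<open>Values of words in the group\<close>

lemma letter_closed [simp]: "a \<in> A \<Longrightarrow> a \<in> carrier G"
  using A_carrier by blast

abbreviation "val \<equiv> word_value G"
abbreviation "wnorm g \<equiv> Cayley_dist G A \<one> g"

lemma val_Nil [simp]: "val [] = \<one>" and val_Cons [simp]: "val (a # w) = a \<otimes> val w"
  by (simp_all add: word_value_def)

lemma val_closed [simp]: "w \<in> lists A \<Longrightarrow> val w \<in> carrier G"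
  using A_carrier by (induction w) auto

lemma val_append [simp]:
  "u \<in> lists A \<Longrightarrow> v \<in> lists A \<Longrightarrow> val (u @ v) = val u \<otimes> val v"
proof (induction u)
  case (Cons a u)
  then show ?case using A_carrier by (auto simp: m_assoc)
qed simp

text \<open>The isomorphism fixes the letters, and multiplicativity then forces it to send the class
  of every word to the value of that word. The two sides of a rule lie in one class.\<close>

lemma val_presented:
  assumes R: "R \<subseteq> lists A \<times> lists A" and pres: "presented_by G A R" and uv: "(u, v) \<in> R"
  shows "val u = val v"
proof -
  let ?E = "mon_cong A R"
  obtain \<phi> where iso: "\<phi> \<in> iso (Mon A R) G" and gens: "\<forall>a\<in>A. \<phi> (?E `` {[a]}) = a"
    using pres unfolding presented_by_def by blast
  have sub: "x \<in> lists A \<and> y \<in> lists A" if "(x, y) \<in> ?E" for x y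
    using that by induction (use R in auto)
  have cls: "?E `` {x} = ?E `` {y}" if "(x, y) \<in> ?E" for x y
    using that by (blast intro: mon_cong.sym mon_cong.trans)
  have self: "x \<in> ?E `` {x}" if "x \<in> lists A" for x
    using that by (auto intro: mon_cong.refl)
  have mult: "(?E `` {x}) \<otimes>\<^bsub>Mon A R\<^esub> (?E `` {y}) = ?E `` {x @ y}"
    if x: "x \<in> lists A" and y: "y \<in> lists A" for x y
  proof -
    have "?E `` {x' @ y'} = ?E `` {x @ y}" if x': "(x, x') \<in> ?E" and y': "(y, y') \<in> ?E" for x' y'
    proof -
      have "(x @ y, x' @ y) \<in> ?E" using mon_cong.compat[OF x', of "[]" y] y by simp
      moreover have "(x' @ y, x' @ y') \<in> ?E"
        using mon_cong.compat[OF y', of x' "[]"] sub[OF x'] by simp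
      ultimately show ?thesis using cls mon_cong.trans by metis
    qed
    then have "(\<Union>x'\<in>?E `` {x}. \<Union>y'\<in>?E `` {y}. ?E `` {x' @ y'})
        = (\<Union>x'\<in>?E `` {x}. \<Union>y'\<in>?E `` {y}. ?E `` {x @ y})" by auto
    also have "\<dots> = ?E `` {x @ y}" using self[OF x] self[OF y] by blast
    finally show ?thesis by (simp add: Mon_def)
  qed
  have car: "?E `` {x} \<in> carrier (Mon A R)" if "x \<in> lists A" for x
    using that by (simp add: Mon_def quotientI)
  have hom: "\<phi> \<in> hom (Mon A R) G" using iso by (simp add: iso_def)
  have hm: "\<phi> (?E `` {x @ y}) = \<phi> (?E `` {x}) \<otimes> \<phi> (?E `` {y})"
    if "x \<in> lists A" "y \<in> lists A" for x y
    using hom_mult[OF hom car[OF that(1)] car[OF that(2)]] mult[OF that] by simp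
  have \<phi>_val: "\<phi> (?E `` {w}) = val w" if "w \<in> lists A" for w
    using that
  proof (induction w)
    case Nil
    \<comment> \<open>Membership in \<open>hom\<close> gives only multiplicativity; the image of the
      empty word is the unit because it is an idempotent of a group.\<close>
    have "\<phi> (?E `` {[]}) \<in> carrier G" using hom_in_carrier[OF hom car] by simp
    moreover have "\<phi> (?E `` {[]}) = \<phi> (?E `` {[]}) \<otimes> \<phi> (?E `` {[]})" using hm[of "[]" "[]"] by simp
    ultimately show ?case by (simp add: l_cancel_one)
  next
    case (Cons a w)
    then show ?case using hm[of "[a]" w] gens by simp
  qed
  have "?E `` {u} = ?E `` {v}" using uv by (intro cls mon_cong.base)
  moreover have "u \<in> lists A" "v \<in> lists A" using uv R by auto
  ultimately show ?thesis using \<phi>_val by metis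
qed

text \<open>A walk is determined by its start and its edge labels, so distances become lengths of
  words. The first edge corresponds to the first letter, hence the induction with varying
  start.\<close>

lemma Cayley_awalk_iff:
  assumes "g \<in> carrier G"
  shows "(\<exists>p. pre_digraph.awalk (Cayley_graph G A) g p h \<and> length p = n) \<longleftrightarrow>
    (\<exists>w \<in> lists A. h = g \<otimes> val w \<and> length w = n)"
  using assms
proof (induction n arbitrary: g)
  case 0
  then show ?case
    by (auto simp: pre_digraph.awalk_def pre_digraph.cas.simps Cayley_graph_def)
next
  case (Suc n)
  have "(\<exists>p. pre_digraph.awalk (Cayley_graph G A) g p h \<and> length p = Suc n) \<longleftrightarrow>
    (\<exists>a\<in>A. \<exists>p. pre_digraph.awalk (Cayley_graph G A) (g \<otimes> a) p h \<and> length p = n)"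
    (is "?L \<longleftrightarrow> ?M")
  proof
    assume ?L
    then obtain e p where "pre_digraph.awalk (Cayley_graph G A) g (e # p) h" "length p = n"
      by (metis length_Suc_conv)
    then show ?M using A_carrier
      by (cases e) (auto simp: pre_digraph.awalk_def pre_digraph.cas.simps Cayley_graph_def)
  next
    assume ?M
    then obtain a p where "a \<in> A" "pre_digraph.awalk (Cayley_graph G A) (g \<otimes> a) p h" "length p = n"
      by blast
    then have "pre_digraph.awalk (Cayley_graph G A) g ((g, a) # p) h \<and> length ((g, a) # p) = Suc n"
      using Suc.prems by (auto simp: pre_digraph.awalk_def pre_digraph.cas.simps Cayley_graph_def)
    then show ?L by blast
  qed
  also have "\<dots> \<longleftrightarrow> (\<exists>a\<in>A. \<exists>w \<in> lists A. h = (g \<otimes> a) \<otimes> val w \<and> length w = n)"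
    by (rule bex_cong[OF HOL.refl Suc.IH]) (use Suc.prems in simp)
  also have "\<dots> \<longleftrightarrow> (\<exists>a\<in>A. \<exists>w \<in> lists A. h = g \<otimes> val (a # w) \<and> length (a # w) = Suc n)"
    using Suc.prems by (intro bex_cong HOL.refl) (simp add: m_assoc)
  also have "\<dots> \<longleftrightarrow> (\<exists>w \<in> lists A. h = g \<otimes> val w \<and> length w = Suc n)"
  proof (intro iffI; elim bexE)
    fix a w
    assume "a \<in> A" "w \<in> lists A" "h = g \<otimes> val (a # w) \<and> length (a # w) = Suc n"
    then show "\<exists>w \<in> lists A. h = g \<otimes> val w \<and> length w = Suc n"
      by (intro bexI[of _ "a # w"]) simp_all
  next
    fix w
    assume w: "w \<in> lists A" "h = g \<otimes> val w \<and> length w = Suc n"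
    then obtain a w' where aw: "w = a # w'" by (cases w) auto
    show "\<exists>a\<in>A. \<exists>w \<in> lists A. h = g \<otimes> val (a # w) \<and> length (a # w) = Suc n"
      using w unfolding aw by (intro bexI[of _ a] bexI[of _ w']) simp_all
  qed
  finally show ?case .
qed

lemma Cayley_dist_eq:
  "g \<in> carrier G \<Longrightarrow> Cayley_dist G A g h = (LEAST n. \<exists>w \<in> lists A. h = g \<otimes> val w \<and> length w = n)"
  by (simp add: Cayley_dist_def Cayley_awalk_iff)

lemma Cayley_dist_le:
  "g \<in> carrier G \<Longrightarrow> w \<in> lists A \<Longrightarrow> Cayley_dist G A g (g \<otimes> val w) \<le> length w"
  unfolding Cayley_dist_eq by (rule Least_le) blast

lemma wnorm_le: "w \<in> lists A \<Longrightarrow> wnorm (val w) \<le> length w"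
  using Cayley_dist_le[of \<one> w] by simp

section \<open>Paths of bounded length inside a ball\<close>

definition ball_steps :: "nat \<Rightarrow> ('a \<times> 'a) set" where
  "ball_steps n = {(g, g \<otimes> a) | g a. a \<in> A \<and> g \<in> Cayley_ball G A n \<and> g \<otimes> a \<in> Cayley_ball G A n}"

text \<open>Relation powers on vertices replace arc lists, which makes composition and reversal
  easy. The power \<open>0\<close> does not force the vertex into the ball, so membership of the
  start is supplied separately when returning to walks.\<close>

definition ball_path :: "nat \<Rightarrow> nat \<Rightarrow> 'a \<Rightarrow> 'a \<Rightarrow> bool" where
  "ball_path n k g h \<longleftrightarrow> (\<exists>j\<le>k. (g, h) \<in> ball_steps n ^^ j)"

lemma ball_path_refl: "ball_path n k g g"
  unfolding ball_path_def by (rule exI[of _ 0]) simp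

lemma ball_path_trans:
  "ball_path n k g h \<Longrightarrow> ball_path n l h f \<Longrightarrow> ball_path n (k + l) g f"
proof -
  assume "ball_path n k g h" "ball_path n l h f"
  then obtain i j where ij: "i \<le> k" "(g, h) \<in> ball_steps n ^^ i" "j \<le> l" "(h, f) \<in> ball_steps n ^^ j"
    unfolding ball_path_def by blast
  have "(g, f) \<in> ball_steps n ^^ (i + j)"
    unfolding relpow_add using ij(2,4) by (rule relcompI)
  with ij(1,3) show "ball_path n (k + l) g f"
    unfolding ball_path_def by (intro exI[of _ "i + j"]) simp
qed

lemma ball_path_mono: "ball_path n k g h \<Longrightarrow> k \<le> l \<Longrightarrow> ball_path n l g h"
  unfolding ball_path_def by (blast intro: le_trans)

lemma ball_path_edge:
  assumes "a \<in> A" "g \<in> Cayley_ball G A n" "g \<otimes> a \<in> Cayley_ball G A n"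
  shows "ball_path n 1 g (g \<otimes> a)"
  unfolding ball_path_def ball_steps_def using assms by (intro exI[of _ 1]) auto

lemma ball_path_sym:
  assumes inv: "\<forall>a\<in>A. inv a \<in> A" and p: "ball_path n k g h"
  shows "ball_path n k h g"
proof -
  have "(x, y) \<in> ball_steps n \<Longrightarrow> (y, x) \<in> ball_steps n" for x y
  proof -
    assume "(x, y) \<in> ball_steps n"
    then obtain a where a: "a \<in> A" "y = x \<otimes> a" "x \<in> Cayley_ball G A n" "y \<in> Cayley_ball G A n"
      unfolding ball_steps_def by blast
    then have "x = y \<otimes> inv a" using A_carrier
      by (auto simp: Cayley_ball_def inv_solve_right subset_iff)
    then have "x = y \<otimes> inv a \<and> inv a \<in> A \<and> y \<otimes> inv a \<in> Cayley_ball G A n" using a inv by simp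
    with a(4) show ?thesis unfolding ball_steps_def by blast
  qed
  note edge_sym = this
  have "(y, x) \<in> ball_steps n ^^ j" if "(x, y) \<in> ball_steps n ^^ j" for j x y
    using that
  proof (induction j arbitrary: y)
    case (Suc j)
    then obtain z where "(x, z) \<in> ball_steps n ^^ j" "(z, y) \<in> ball_steps n" by auto
    then show ?case using relpow_Suc_I2 Suc.IH edge_sym by metis
  qed simp
  with p show ?thesis unfolding ball_path_def by blast
qed

text \<open>Each vertex passed is the value of a prefix of \<open>p @ w\<close>, and the length of
  that prefix, at most \<open>n\<close>, bounds its norm.\<close>

lemma ball_path_word:
  assumes "p \<in> lists A" "w \<in> lists A" "length p + length w \<le> n"
  shows "ball_path n (length w) (val p) (val p \<otimes> val w)"
  using assms
proof (induction w arbitrary: p)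
  case Nil
  then show ?case by (simp add: ball_path_refl)
next
  case (Cons a w)
  have pa: "val (p @ [a]) = val p \<otimes> a" using Cons.prems by auto
  have "wnorm (val p) \<le> n" "wnorm (val (p @ [a])) \<le> n"
    using Cons.prems wnorm_le[of p] wnorm_le[of "p @ [a]"] by auto
  then have "ball_path n 1 (val p) (val p \<otimes> a)"
    using Cons.prems pa
    by (intro ball_path_edge) (auto simp: Cayley_ball_def simp del: val_append)
  moreover have "ball_path n (length w) (val p \<otimes> a) (val p \<otimes> a \<otimes> val w)"
    using Cons.IH[of "p @ [a]"] Cons.prems unfolding pa[symmetric] by auto
  ultimately have "ball_path n (1 + length w) (val p) (val p \<otimes> a \<otimes> val w)"
    by (rule ball_path_trans)
  then show ?case using Cons.prems A_carrier by (auto simp: m_assoc)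
qed

lemma awalk_if_ball_path:
  assumes "ball_path n k g h" "g \<in> Cayley_ball G A n"
  shows "\<exists>p. pre_digraph.awalk (Cayley_graph G A \<restriction> Cayley_ball G A n) g p h \<and> length p \<le> k"
proof -
  have "\<exists>p. pre_digraph.awalk (Cayley_graph G A \<restriction> Cayley_ball G A n) g p h \<and> length p = j"
    if "(g, h) \<in> ball_steps n ^^ j" "g \<in> Cayley_ball G A n" for j g
    using that
  proof (induction j arbitrary: g)
    case 0
    then show ?case
      by (auto simp: pre_digraph.awalk_def pre_digraph.cas.simps induce_subgraph_def)
  next
    case (Suc j)
    then obtain a where a: "a \<in> A" "g \<otimes> a \<in> Cayley_ball G A n" "(g \<otimes> a, h) \<in> ball_steps n ^^ j"
      using relpow_Suc_D2[OF Suc.prems(1)] unfolding ball_steps_def[of n] by blast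
    from Suc.IH[OF a(3,2)] obtain p where
      "pre_digraph.awalk (Cayley_graph G A \<restriction> Cayley_ball G A n) (g \<otimes> a) p h" "length p = j" by blast
    then have "pre_digraph.awalk (Cayley_graph G A \<restriction> Cayley_ball G A n) g ((g, a) # p) h"
      using a Suc.prems
      by (auto simp: pre_digraph.awalk_def pre_digraph.cas.simps induce_subgraph_def
          Cayley_graph_def Cayley_ball_def)
    with \<open>length p = j\<close> show ?case by (metis length_Cons)
  qed
  with assms show ?thesis unfolding ball_path_def by blast
qed

end

section \<open>Normal forms of a length non-increasing system\<close>

locale length_nonincreasing_rewriting = group_alphabet G A for G (structure) and A +
  fixes R
  assumes inv_A: "\<forall>a\<in>A. inv a \<in> A"
    and finite_A: "finite A"
    and convergent: "convergent_prefix_rewriting_system G A R"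
    and nonincreasing: "length_nonincreasing R"
begin

lemma R_lists: "(u, v) \<in> R \<Longrightarrow> u \<in> lists A \<and> v \<in> lists A"
  using convergent unfolding convergent_prefix_rewriting_system_def by blast

lemma val_rule: "(u, v) \<in> R \<Longrightarrow> val u = val v"
  using convergent unfolding convergent_prefix_rewriting_system_def by (blast intro: val_presented)

lemma wf_steps: "wf ((prefix_step A R)\<inverse>)"
  using convergent
  unfolding convergent_prefix_rewriting_system_def wf_iff_no_infinite_down_chain by simp

lemma prefix_step_invariants:
  assumes "(x, y) \<in> prefix_step A R"
  shows "x \<in> lists A \<and> y \<in> lists A \<and> val x = val y \<and> length y \<le> length x"
proof -
  obtain u v w where xy: "x = u @ w" "y = v @ w" and uv: "(u, v) \<in> R" and w: "w \<in> lists A"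
    using assms unfolding prefix_step_def by blast
  have "length v \<le> length u" using nonincreasing uv unfolding length_nonincreasing_def by blast
  then show ?thesis using R_lists[OF uv] val_rule[OF uv] w unfolding xy by simp
qed

lemma prefix_steps_invariants:
  assumes "(x, y) \<in> (prefix_step A R)\<^sup>*" "x \<in> lists A"
  shows "y \<in> lists A \<and> val x = val y \<and> length y \<le> length x"
  using assms
proof (induction rule: rtrancl_induct)
  case (step y z)
  then show ?case using prefix_step_invariants[of y z] by auto
qed simp

lemma prefix_steps_append:
  assumes "(x, y) \<in> (prefix_step A R)\<^sup>*" "w \<in> lists A"
  shows "(x @ w, y @ w) \<in> (prefix_step A R)\<^sup>*"
  using assms(1)
proof (induction rule: rtrancl_induct)
  case (step y z)
  have "(y @ w, z @ w) \<in> prefix_step A R"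
    using step(2) assms(2) unfolding prefix_step_def by force
  with step(3) show ?case by (rule rtrancl_into_rtrancl)
qed simp

lemma ex_normal_form:
  "x \<in> lists A \<Longrightarrow> \<exists>y. (x, y) \<in> (prefix_step A R)\<^sup>* \<and> irreducible_word A R y"
proof (induction x rule: wf_induct_rule[OF wf_steps])
  case (1 x)
  show ?case
  proof (cases "irreducible_word A R x")
    case False
    with 1(2) obtain x' where x': "(x, x') \<in> prefix_step A R"
      unfolding irreducible_word_def by blast
    have "(x', x) \<in> (prefix_step A R)\<inverse>" "x' \<in> lists A" using x' prefix_step_invariants by auto
    from 1(1)[OF this] x' show ?thesis by (blast intro: converse_rtrancl_into_rtrancl)
  qed blast
qed

lemma ex1_irreducible: "g \<in> carrier G \<Longrightarrow> \<exists>!w. irreducible_word A R w \<and> val w = g"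
  using convergent unfolding convergent_prefix_rewriting_system_def by blast

lemma irreducible_unique:
  assumes "irreducible_word A R x" "irreducible_word A R y" "val x = val y"
  shows "x = y"
proof -
  have "val x \<in> carrier G" using assms(1) unfolding irreducible_word_def by simp
  from ex1_irreducible[OF this] assms show ?thesis by auto
qed

section \<open>Geodesic words and geodesic normal forms\<close>

lemma ex_word:
  assumes "g \<in> carrier G" obtains w where "w \<in> lists A" "val w = g"
  using ex1_irreducible[OF assms] unfolding irreducible_word_def by blast

text \<open>The \<open>LEAST\<close> in the distance is attained: \<open>inv g \<otimes> h\<close>,
  like every element, is the value of an irreducible word.\<close>

lemma Cayley_dist_word:
  assumes "g \<in> carrier G" "h \<in> carrier G"
  obtains w where "w \<in> lists A" "h = g \<otimes> val w" "length w = Cayley_dist G A g h"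
proof -
  obtain w where "w \<in> lists A" "val w = inv g \<otimes> h"
    by (rule ex_word[of "inv g \<otimes> h"]) (use assms in auto)
  then have "\<exists>w \<in> lists A. h = g \<otimes> val w"
    using assms by (intro bexI[of _ w]) (simp_all add: m_assoc[symmetric])
  then have "\<exists>n. \<exists>w \<in> lists A. h = g \<otimes> val w \<and> length w = n" by blast
  from LeastI_ex[OF this] show ?thesis
    unfolding Cayley_dist_eq[OF assms(1), symmetric] using that by blast
qed

lemma geodesic_word:
  assumes "g \<in> carrier G"
  obtains w where "w \<in> lists A" "val w = g" "length w = wnorm g"
proof -
  obtain w where w: "w \<in> lists A" "g = \<one> \<otimes> val w" "length w = wnorm g"
    using Cayley_dist_word[OF one_closed assms] .
  from w that[of w] show ?thesis by simp
qed

lemma wnorm_mult_le: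
  assumes "g \<in> carrier G" "a \<in> A"
  shows "wnorm (g \<otimes> a) \<le> Suc (wnorm g)"
proof -
  obtain w where w: "w \<in> lists A" "val w = g" "length w = wnorm g"
    by (rule geodesic_word[OF assms(1)])
  then have "val (w @ [a]) = g \<otimes> a" using assms by simp
  then show ?thesis using wnorm_le[of "w @ [a]"] w(1,3) assms(2) by simp
qed

text \<open>A geodesic word for the same element rewrites, without growing, to an irreducible word,
  which by uniqueness is \<open>x\<close>.\<close>

lemma normal_form_geodesic:
  assumes "irreducible_word A R x"
  shows "length x = wnorm (val x)"
proof -
  have x: "x \<in> lists A" using assms unfolding irreducible_word_def by blast
  obtain w where w: "w \<in> lists A" "val w = val x" "length w = wnorm (val x)"
    by (rule geodesic_word[OF val_closed[OF x]])
  obtain y where y: "(w, y) \<in> (prefix_step A R)\<^sup>*" "irreducible_word A R y"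
    using ex_normal_form[OF w(1)] by blast
  have inv: "val w = val y" "length y \<le> length w"
    using prefix_steps_invariants[OF y(1) w(1)] by simp_all
  have "y = x" by (rule irreducible_unique[OF y(2) assms]) (use inv(1) w(2) in simp)
  then have "length x \<le> wnorm (val x)" using inv(2) w(3) by simp
  then show ?thesis using wnorm_le[OF x] by (rule order_antisym)
qed

text \<open>If the applicable rule left a nonempty suffix of \<open>w @ [a]\<close> untouched, it
  would already apply to \<open>w\<close>.\<close>

lemma reducible_snoc_rule:
  assumes w: "irreducible_word A R w" and a: "a \<in> A" and red: "\<not> irreducible_word A R (w @ [a])"
  obtains v where "(w @ [a], v) \<in> R"
proof -
  have wA: "w \<in> lists A" using w unfolding irreducible_word_def by blast
  then have "w @ [a] \<in> lists A" using a by simp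
  with red obtain y where "(w @ [a], y) \<in> prefix_step A R"
    unfolding irreducible_word_def by blast
  then obtain u v t where uv: "(u, v) \<in> R" "t \<in> lists A" "w @ [a] = u @ t"
    unfolding prefix_step_def by blast
  show ?thesis
  proof (cases t rule: rev_cases)
    case Nil
    with uv that show ?thesis by simp
  next
    case (snoc t' b)
    then have "w = u @ t'" "t' \<in> lists A" using uv by auto
    then have "(w, v @ t') \<in> prefix_step A R" using uv(1) unfolding prefix_step_def by blast
    with w show ?thesis unfolding irreducible_word_def by blast
  qed
qed

text \<open>Only the first \<open>n - C\<close> letters of both sides are kept. A rule completing
  these prefixes joins them in \<open>2 * C\<close> steps, and the stretches from the prefixes to
  \<open>w\<close> and to \<open>x\<close> cost \<open>C\<close> each. For \<open>C \<le> n\<close>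
  the completed sides have length at most \<open>n\<close>, so the path stays in the ball.\<close>

lemma rule_ball_path:
  assumes C: "\<And>u v m. (u, v) \<in> R \<Longrightarrow> m \<le> length u \<Longrightarrow> m \<le> length v \<Longrightarrow>
      \<exists>r s. (take m u @ r, take m v @ s) \<in> R \<and> length r \<le> C \<and> length s \<le> C"
    and rule: "(w @ [a], x @ [c]) \<in> R" and len: "length w = n" "length x = n"
  shows "ball_path n (4 * C) (val w) (val x)"
proof -
  have wx: "w \<in> lists A" "x \<in> lists A" using R_lists[OF rule] by auto
  define m where "m = n - C"
  define p q where "p = take m w" and "q = take m x"
  have pq: "p \<in> lists A" "q \<in> lists A" using wx unfolding p_def q_def by (auto dest: in_set_takeD)
  have lpq: "length p = m" "length q = m" unfolding p_def q_def m_def using len by auto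
  have up: "ball_path n C (val (take m y)) (val y)" if "y \<in> lists A" "length y = n" for y
  proof -
    have td: "take m y \<in> lists A" "drop m y \<in> lists A"
      using that by (auto dest: in_set_takeD in_set_dropD)
    have "ball_path n (length (drop m y)) (val (take m y)) (val (take m y) \<otimes> val (drop m y))"
      using td that by (intro ball_path_word) auto
    moreover have "val (take m y) \<otimes> val (drop m y) = val y"
      using val_append[OF td] by simp
    ultimately show ?thesis using that by (auto simp: m_def elim: ball_path_mono)
  qed
  have across: "ball_path n (2 * C) (val p) (val q)"
  proof (cases "C \<le> n")
    case True
    have "m \<le> length (w @ [a])" "m \<le> length (x @ [c])" using len unfolding m_def by auto
    from C[OF rule this] obtain r s where rs: "(p @ r, q @ s) \<in> R" "length r \<le> C" "length s \<le> C"
      using len unfolding p_def q_def m_def by auto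
    have rsA: "r \<in> lists A" "s \<in> lists A" using R_lists[OF rs(1)] by auto
    have "ball_path n C (val p) (val p \<otimes> val r)" and q: "ball_path n C (val q) (val q \<otimes> val s)"
      using ball_path_mono[OF ball_path_word[OF pq(1) rsA(1)] rs(2)]
        ball_path_mono[OF ball_path_word[OF pq(2) rsA(2)] rs(3)] rs(2,3) lpq True
      by (auto simp: m_def)
    moreover have "val p \<otimes> val r = val q \<otimes> val s"
      using val_rule[OF rs(1)] pq rsA by simp
    ultimately have "ball_path n (C + C) (val p) (val q)"
      using ball_path_trans[OF _ ball_path_sym[OF inv_A q]] by simp
    then show ?thesis by (simp add: mult_2)
  next
    case False
    \<comment> \<open>Truncated subtraction gives \<open>m = 0\<close>, so both prefixes are
      empty.\<close>
    then have "p = q" using lpq unfolding m_def by simp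
    then show ?thesis by (simp add: ball_path_refl)
  qed
  have "ball_path n (C + 2 * C + C) (val w) (val x)"
    using ball_path_trans[OF ball_path_trans[OF ball_path_sym[OF inv_A up[OF wx(1) len(1)]]
        across[unfolded p_def q_def]] up[OF wx(2) len(2)]] .
  then show ?thesis by (rule ball_path_mono) simp
qed

text \<open>
  Only reachability of the normal form is established by termination; the number of moves is
  bounded because they take place in the finite set of neighbours of \<open>e\<close>.
\<close>

lemma ball_path_to_normal_form:
  assumes C: "\<And>u v m. (u, v) \<in> R \<Longrightarrow> m \<le> length u \<Longrightarrow> m \<le> length v \<Longrightarrow>
      \<exists>r s. (take m u @ r, take m v @ s) \<in> R \<and> length r \<le> C \<and> length s \<le> C"
    and e: "wnorm e = Suc n" and z: "irreducible_word A R z" "val z = e"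
    and g: "g \<in> carrier G" "wnorm g = n" and a: "a \<in> A" and ga: "g \<otimes> a = e"
  shows "ball_path n ((card A * card A) * (4 * C)) g (val (butlast z))"
proof -
  \<comment> \<open>These are the neighbours of \<open>e\<close>. Every word ending at
    \<open>e\<close> has its penultimate vertex here, which confines the moves to a set of at most
    \<open>card A\<close> vertices.\<close>
  define N where "N = (\<lambda>a. e \<otimes> inv a) ` A"
  have N: "finite N" "card N \<le> card A"
    unfolding N_def using finite_A by (auto intro: card_image_le)
  define T where "T = {(f, f') \<in> N \<times> N. ball_path n (4 * C) f f'}"
  have inN: "val x \<in> N" if "x \<in> lists A" "c \<in> A" "val (x @ [c]) = e" for x c
  proof -
    have "e = val x \<otimes> c" using that by simp
    then have "val x = e \<otimes> inv c" using that(1,2) by (simp add: m_assoc)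
    with that show ?thesis unfolding N_def by blast
  qed
  have reach: "(val w, val (butlast z)) \<in> T\<^sup>*"
    if "y = w @ [b]" "b \<in> A" "irreducible_word A R w" "length w = n" "val (w @ [b]) = e" for y w b
    using that
  \<comment> \<open>One round applies a rule to \<open>y\<close> and then normalises all but the
    last letter of the result. It may take several rewriting steps but takes at least one, hence the
    transitive closure.\<close>
  proof (induction y arbitrary: w b rule: wf_induct_rule[OF wf_trancl[OF wf_steps]])
    case (1 y)
    have wA: "w \<in> lists A" using 1(4) unfolding irreducible_word_def by blast
    show ?case
    proof (cases "irreducible_word A R (w @ [b])")
      case True
      then have "w @ [b] = z" using irreducible_unique z 1(6) by simp
      then show ?thesis by auto
    next
      case False
      obtain v where v: "(w @ [b], v) \<in> R" using reducible_snoc_rule[OF 1(4,3) False] .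
      have vA: "v \<in> lists A" and ve: "val v = e" using R_lists[OF v] val_rule[OF v] 1(6) by auto
      \<comment> \<open>Rewriting does not lengthen, and no word for \<open>e\<close> is shorter
        than \<open>Suc n\<close>. So \<open>v\<close> has exactly this length, and removing its
        last letter leaves a word of length \<open>n\<close>.\<close>
      have "length v \<le> Suc n" using nonincreasing v 1(5) unfolding length_nonincreasing_def by force
      moreover have "Suc n \<le> length v" using wnorm_le[OF vA] ve e by simp
      ultimately have "length v = Suc n" by simp
      then obtain x c where xc: "v = x @ [c]" "length x = n"
        by (cases v rule: rev_cases) auto
      have x: "x \<in> lists A" and c: "c \<in> A" using vA xc by auto
      obtain x' where x': "(x, x') \<in> (prefix_step A R)\<^sup>*" "irreducible_word A R x'"
        using ex_normal_form[OF x] by blast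
      have inv: "x' \<in> lists A \<and> val x = val x' \<and> length x' \<le> length x"
        using prefix_steps_invariants[OF x'(1) x] .
      have x'e: "val (x' @ [c]) = e" using inv x c ve xc by simp
      \<comment> \<open>The same lower bound keeps the normalisation of \<open>x\<close> from
        shortening it.\<close>
      have "Suc n \<le> length (x' @ [c])" using wnorm_le[of "x' @ [c]"] x'e e inv c by simp
      then have lx': "length x' = n" using inv xc by simp
      have "(w @ [b], v) \<in> prefix_step A R" using v unfolding prefix_step_def by force
      moreover have "(v, x' @ [c]) \<in> (prefix_step A R)\<^sup>*"
        unfolding xc using prefix_steps_append[OF x'(1)] c by simp
      ultimately have steps: "(y, x' @ [c]) \<in> (prefix_step A R)\<^sup>+"
        unfolding 1(2) by (rule rtrancl_into_trancl2)
      have IH: "(val x', val (butlast z)) \<in> T\<^sup>*"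
        using 1(1)[OF _ HOL.refl c x'(2) lx' x'e] steps by (simp add: trancl_converse)
      have "ball_path n (4 * C) (val w) (val x)"
        by (rule rule_ball_path[OF C v[unfolded xc(1)] 1(5) xc(2)])
      then have "(val w, val x') \<in> T"
        unfolding T_def using inN[OF wA 1(3,6)] inN[OF _ c x'e] inv by auto
      then show ?thesis using IH by (rule converse_rtrancl_into_rtrancl)
    qed
  qed
  obtain w where w: "w \<in> lists A" "val w = g" using ex_word[OF g(1)] .
  then obtain w' where w': "(w, w') \<in> (prefix_step A R)\<^sup>*" "irreducible_word A R w'"
    using ex_normal_form by blast
  have inv: "w' \<in> lists A" "val w' = g" using prefix_steps_invariants[OF w'(1) w(1)] w by auto
  have "(g, val (butlast z)) \<in> T\<^sup>*"
    using reach[OF HOL.refl a w'(2)] normal_form_geodesic[OF w'(2)] inv g a ga A_carrier by auto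
  moreover have T: "T \<subseteq> N \<times> N" unfolding T_def by auto
  then have "finite T" using N finite_subset by blast
  \<comment> \<open>In a finite relation, reachability needs at most as many steps as there are
    pairs. This and \<open>T \<subseteq> N \<times> N\<close> produce the factor
    \<open>card A * card A\<close>.\<close>
  ultimately obtain j where j: "j \<le> card T" "(g, val (butlast z)) \<in> T ^^ j"
    using rtrancl_finite_eq_relpow[of T] by auto
  have "card T \<le> card N * card N" using card_mono[OF _ T] N by (simp add: card_cartesian_product)
  also have "\<dots> \<le> card A * card A" using N by (simp add: mult_le_mono)
  finally have jA: "j \<le> card A * card A" using j by simp
  have "ball_path n (i * (4 * C)) f f'" if "(f, f') \<in> T ^^ i" for i f f'
    using that
  proof (induction i arbitrary: f')
    case 0
    then show ?case by (simp add: ball_path_refl)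
  next
    case (Suc i)
    then obtain h where "(f, h) \<in> T ^^ i" "(h, f') \<in> T" by auto
    then have "ball_path n (i * (4 * C) + 4 * C) f f'"
      using Suc.IH ball_path_trans unfolding T_def by blast
    then show ?case by (simp add: add.commute)
  qed
  from this[OF j(2)] show ?thesis by (rule ball_path_mono) (use jA in \<open>rule mult_le_mono1\<close>)
qed

section \<open>Almost convexity by cases on the connecting word of length at most two\<close>

lemma almost_convex:
  assumes "synchronously_regular A R"
  shows "almost_convex G A"
proof -
  obtain C where C: "\<And>u v m. (u, v) \<in> R \<Longrightarrow> m \<le> length u \<Longrightarrow> m \<le> length v \<Longrightarrow>
      \<exists>r s. (take m u @ r, take m v @ s) \<in> R \<and> length r \<le> C \<and> length s \<le> C"
    using synchronously_regular_completion[OF assms] by blast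
  \<comment> \<open>\<open>K\<close> bounds the path from \<open>g\<close> or \<open>h\<close> to
    the penultimate vertex of the normal form of \<open>e\<close>. The summand \<open>2\<close> in
    the final constant covers paths of length at most two that already lie in the ball.\<close>
  define K where "K = (card A * card A) * (4 * C)"
  have path: "ball_path n (K + K + 2) g h"
    if g: "g \<in> Cayley_sphere G A n" and h: "h \<in> Cayley_sphere G A n"
      and d: "Cayley_dist G A g h \<le> 2" for n g h
  proof -
    have gh: "g \<in> carrier G" "h \<in> carrier G" "wnorm g = n" "wnorm h = n"
      using g h unfolding Cayley_sphere_def by auto
    then have gB: "g \<in> Cayley_ball G A n" and hB: "h \<in> Cayley_ball G A n"
      unfolding Cayley_ball_def by auto
    obtain w where w: "w \<in> lists A" "h = g \<otimes> val w" "length w \<le> 2"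
      by (rule Cayley_dist_word[OF gh(1,2)]) (use d in simp)
    then consider "w = []" | a where "w = [a]" | a b where "w = [a, b]"
      by (cases w rule: remdups_adj.cases) auto
    then show ?thesis
    proof cases
      case 1
      then show ?thesis using w gh by (simp add: ball_path_refl)
    next
      case (2 a)
      then have "h = g \<otimes> a" "a \<in> A" using w A_carrier by auto
      then have "ball_path n 1 g h" using ball_path_edge gB hB by simp
      then show ?thesis by (rule ball_path_mono) simp
    next
      case (3 a b)
      define e where "e = g \<otimes> a"
      have ab: "a \<in> A" "b \<in> A" "a \<in> carrier G" "b \<in> carrier G" using 3 w A_carrier by auto
      have e: "e \<in> carrier G" unfolding e_def using gh ab by simp
      have h_eq: "h = e \<otimes> b" unfolding e_def using 3 w gh ab by (simp add: m_assoc)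
      have "wnorm e \<le> Suc n" unfolding e_def using wnorm_mult_le[OF gh(1) ab(1)] gh by simp
      then consider "wnorm e \<le> n" | "wnorm e = Suc n" by linarith
      then show ?thesis
      proof cases
        case 1
        then have "e \<in> Cayley_ball G A n" using e unfolding Cayley_ball_def by simp
        then have "ball_path n 1 g e" "ball_path n 1 e h"
          using ball_path_edge[OF ab(1) gB, folded e_def]
            ball_path_edge[OF ab(2) _ hB[unfolded h_eq], folded h_eq] by blast+
        then have "ball_path n (1 + 1) g h" by (rule ball_path_trans)
        then show ?thesis by (rule ball_path_mono) simp
      next
        case 2
        obtain z where z: "irreducible_word A R z" "val z = e"
          using ex1_irreducible[OF e] by blast
        \<comment> \<open>Reversing the second edge puts \<open>h\<close> in the same position as
          \<open>g\<close>, so both are joined to the same vertex.\<close>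
        have "h \<otimes> inv b = e" unfolding h_eq using e ab by (simp add: m_assoc)
        moreover have "inv b \<in> A" using inv_A ab by blast
        ultimately have "ball_path n K h (val (butlast z))"
          unfolding K_def by (intro ball_path_to_normal_form[OF C 2 z gh(2,4)])
        moreover have "ball_path n K g (val (butlast z))"
          unfolding K_def by (rule ball_path_to_normal_form[OF C 2 z gh(1,3) ab(1) e_def[symmetric]])
        ultimately have "ball_path n (K + K) g h"
          using ball_path_trans ball_path_sym[OF inv_A] by blast
        then show ?thesis by (rule ball_path_mono) simp
      qed
    qed
  qed
  show ?thesis
    unfolding almost_convex_def
  proof (intro exI[of _ "K + K + 2"] allI ballI impI)
    fix n g h
    assume gh: "g \<in> Cayley_sphere G A n" "h \<in> Cayley_sphere G A n" "Cayley_dist G A g h \<le> 2"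
    have "g \<in> Cayley_ball G A n" using gh(1) unfolding Cayley_sphere_def Cayley_ball_def by auto
    with path[OF gh] show "\<exists>p. pre_digraph.awalk (Cayley_graph G A \<restriction> Cayley_ball G A n) g p h \<and>
        length p \<le> K + K + 2"
      by (rule awalk_if_ball_path)
  qed
qed

end

theorem theoremB:
  fixes G :: "('a, 'b) monoid_scheme" and A :: "'a set"
  assumes "group G"
    and "A \<subseteq> carrier G" and "finite A" and "generate G A = carrier G"
    and "\<forall>a\<in>A. inv\<^bsub>G\<^esub> a \<in> A"
    and "\<exists>R. convergent_prefix_rewriting_system G A R \<and> synchronously_regular A R \<and>
             length_nonincreasing R"
  shows "almost_convex G A"
proof -
  obtain R where R: "convergent_prefix_rewriting_system G A R" "synchronously_regular A R"
    "length_nonincreasing R" using assms(6) by blast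
  interpret group G by (rule assms(1))
  interpret length_nonincreasing_rewriting G A R
    by unfold_locales (use assms R in auto)
  show ?thesis using R(2) by (rule almost_convex)
qed

end
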